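(* Let $\mathcal{X},\mathcal{Y},\mathcal{Z}$ be finite alphabets and $P_{XYZ}$ a joint distribution on $\mathcal{X}\times\mathcal{Y}\times\mathcal{Z}$. Then the conditional maximal leakage from $X$ to $Y$ given $Z$ is $$\mathcal{L}(X\to Y|Z)=\log\left(\max_{z:\,P_Z(z)>0}\ \sum_{y\in\mathcal{Y}}\ \max_{x:\,P_{X|Z}(x|z)>0}P_{Y|XZ}(y|x,z)\right).$$
   Context: $\log$ is the natural logarithm. The conditional maximal leakage is $$\mathcal{L}(X\to Y|Z)=\sup_{U:\,U-X-Y|Z}\log\frac{\Pr(U=\hat U(Y,Z))}{\Pr(U=\tilde U(Z))},$$ where $U$ takes values in a finite, but arbitrary, alphabet; $U-X-Y|Z$ means that $U$ and $Y$ are conditionally independent given $(X,Z)$ (equivalently, $U-(X,Z)-Y$ is a Markov chain); and $\hat U(Y,Z)$ and $\tilde U(Z)$ are the optimal (maximum a posteriori) estimators of $U$ given $(Y,Z)$ and given $Z$, respectively. *)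

theory Defs
  imports "HOL-Probability.Probability"
begin

definition cond_indep :: "'a pmf \<Rightarrow> ('a \<Rightarrow> 'u) \<Rightarrow> ('a \<Rightarrow> 'v) \<Rightarrow> ('a \<Rightarrow> 'w) \<Rightarrow> bool" where
  "cond_indep Q U V W \<longleftrightarrow>
     (\<forall>u v w. \<P>(\<omega> in measure_pmf Q. W \<omega> = w) > 0 \<longrightarrow>
        \<P>(\<omega> in measure_pmf Q. U \<omega> = u \<and> V \<omega> = v \<bar> W \<omega> = w) =
        \<P>(\<omega> in measure_pmf Q. U \<omega> = u \<bar> W \<omega> = w) * \<P>(\<omega> in measure_pmf Q. V \<omega> = v \<bar> W \<omega> = w))"

text \<open>
  Maximum a posteriori estimators, with values in the alphabet \<open>A\<close>, of \<open>U\<close> given \<open>W\<close>. On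
  observations \<open>w\<close> of probability zero there is no posterior and the value is arbitrary.
\<close>

definition MAP_estimator :: "'a pmf \<Rightarrow> 'u set \<Rightarrow> ('a \<Rightarrow> 'u) \<Rightarrow> ('a \<Rightarrow> 'w) \<Rightarrow> ('w \<Rightarrow> 'u) \<Rightarrow> bool" where
  "MAP_estimator Q A U W e \<longleftrightarrow>
     (\<forall>w. e w \<in> A) \<and>
     (\<forall>w. \<P>(\<omega> in measure_pmf Q. W \<omega> = w) > 0 \<longrightarrow>
        (\<forall>u\<in>A. \<P>(\<omega> in measure_pmf Q. U \<omega> = u \<bar> W \<omega> = w)
              \<le> \<P>(\<omega> in measure_pmf Q. U \<omega> = e w \<bar> W \<omega> = w)))"

text \<open>
  The supremum over \<open>U\<close> ranges over all joint laws \<open>Q\<close> of \<open>(U, X, Y, Z)\<close> whose \<open>(X, Y, Z)\<close>-marginal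
  is the given \<open>P\<close>. Only the joint law matters, so the arbitrary finite alphabet of \<open>U\<close> is
  represented, up to relabelling, by an arbitrary finite set \<open>A\<close> of natural numbers. The value
  does not depend on which maximum a posteriori estimators are chosen. The supremum is taken
  in \<^typ>\<open>ereal\<close> so that it is meaningful without a prior boundedness argument.
\<close>

definition cond_maximal_leakage :: "('x \<times> 'y \<times> 'z) pmf \<Rightarrow> ereal" where
  "cond_maximal_leakage P =
     Sup {ereal (ln (\<P>((u, x, y, z) in measure_pmf Q. u = Uhat (y, z)) /
                     \<P>((u, x, y, z) in measure_pmf Q. u = Utilde z)))
          | (A :: nat set) (Q :: (nat \<times> 'x \<times> 'y \<times> 'z) pmf) Uhat Utilde.
            finite A \<and>
            fst ` set_pmf Q \<subseteq> A \<and>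
            map_pmf snd Q = P \<and>
            cond_indep Q (\<lambda>(u, x, y, z). u) (\<lambda>(u, x, y, z). y) (\<lambda>(u, x, y, z). (x, z)) \<and>
            MAP_estimator Q A (\<lambda>(u, x, y, z). u) (\<lambda>(u, x, y, z). (y, z)) Uhat \<and>
            MAP_estimator Q A (\<lambda>(u, x, y, z). u) (\<lambda>(u, x, y, z). z) Utilde}"

end

theory Submission
  imports Defs
begin

text \<open>
  For the upper bound, conditional independence and optimality of \<open>Utilde\<close> give
  \<open>P(U = u, Y = y, Z = z) \<le> m(y,z) P(U = u, Z = z) \<le> m(y,z) P(U = Utilde z, Z = z)\<close>, where
  \<open>m(y,z)\<close> is the inner maximum; then put \<open>u = Uhat(y,z)\<close> and sum over \<open>y\<close> and \<open>z\<close>.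

  For the lower bound, fix a maximizing \<open>z0\<close> and a \<open>\<delta> > 0\<close> with \<open>\<delta> \<le> P(x,z0)\<close> whenever
  \<open>P(x,z0) > 0\<close>. If \<open>Z = z0\<close>, let \<open>U\<close> reveal \<open>X\<close> with probability \<open>\<delta> / P(X,z0)\<close>; in all remaining
  cases \<open>U\<close> is uniform on \<open>N\<close> letters, which may overlap with those naming elements of the
  alphabet of \<open>X\<close>. Then \<open>P(U = x, Z = z0) \<ge> \<delta>\<close> for every such \<open>x\<close>, so guessing \<open>U\<close> from
  \<open>(Y,Z)\<close> succeeds with probability at least \<open>\<delta> (\<Sum>y. m(y,z0))\<close>, whereas guessing from \<open>Z\<close>
  succeeds with probability at most \<open>\<delta> + 1/N\<close>. Let \<open>N \<rightarrow> \<infinity>\<close>.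
\<close>

section \<open>Sums over fibres, MAP estimators and conditional independence\<close>

lemma prob_eq_sum_fibres:
  fixes W :: "'a \<Rightarrow> 'w::finite"
  shows "measure_pmf.prob Q {\<omega>. R \<omega>} = (\<Sum>w\<in>UNIV. measure_pmf.prob Q {\<omega>. R \<omega> \<and> W \<omega> = w})"
proof -
  have "{\<omega>. R \<omega>} = (\<Union>w\<in>UNIV. {\<omega>. R \<omega> \<and> W \<omega> = w})" by auto
  then show ?thesis
    by (simp add: disjoint_family_on_def measure_pmf.finite_measure_finite_Union Int_def)
qed

lemma success_prob_eq_sum:
  fixes W :: "'a \<Rightarrow> 'w::finite"
  shows "measure_pmf.prob Q {\<omega>. U \<omega> = e (W \<omega>)} =
    (\<Sum>w\<in>UNIV. measure_pmf.prob Q {\<omega>. U \<omega> = e w \<and> W \<omega> = w})"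
  by (subst prob_eq_sum_fibres[where W = W]) (intro sum.cong arg_cong[where f = "measure_pmf.prob Q"]; auto)

text \<open>Multiplying the posterior inequality by the probability of \<open>W = w\<close> clears
  the denominators. In this joint form it also covers observations of probability zero, where both
  sides vanish whatever the arbitrary value \<open>e w\<close> is.\<close>

lemma MAP_estimator_optimal:
  assumes "MAP_estimator Q A U W e" "u \<in> A"
  shows "measure_pmf.prob Q {\<omega>. U \<omega> = u \<and> W \<omega> = w} \<le> measure_pmf.prob Q {\<omega>. U \<omega> = e w \<and> W \<omega> = w}"
proof (cases "measure_pmf.prob Q {\<omega>. W \<omega> = w} > 0")
  case True
  then show ?thesis
    using assms by (auto simp: MAP_estimator_def cond_prob_def divide_le_cancel)
next
  case False
  then have "measure_pmf.prob Q {\<omega>. W \<omega> = w} = 0"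
    by (simp add: zero_less_measure_iff)
  moreover have "measure_pmf.prob Q {\<omega>. U \<omega> = u \<and> W \<omega> = w} \<le> measure_pmf.prob Q {\<omega>. W \<omega> = w}"
    by (intro measure_pmf.finite_measure_mono) auto
  ultimately show ?thesis
    by (metis measure_nonneg order_trans)
qed

lemma MAP_estimator_exists:
  assumes "finite A" "A \<noteq> {}"
  obtains e where "MAP_estimator Q A U W e"
proof -
  have "\<exists>a\<in>A. \<forall>u\<in>A. \<P>(\<omega> in measure_pmf Q. U \<omega> = u \<bar> W \<omega> = w) \<le> \<P>(\<omega> in measure_pmf Q. U \<omega> = a \<bar> W \<omega> = w)"
    for w
  proof -
    let ?f = "\<lambda>u. \<P>(\<omega> in measure_pmf Q. U \<omega> = u \<bar> W \<omega> = w)"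
    have "Max (?f ` A) \<in> ?f ` A" using assms by (intro Max_in) auto
    then obtain a where "a \<in> A" "?f a = Max (?f ` A)" by force
    then show ?thesis using assms by (intro bexI[of _ a]) auto
  qed
  then obtain e where "\<And>w. e w \<in> A \<and> (\<forall>u\<in>A. \<P>(\<omega> in measure_pmf Q. U \<omega> = u \<bar> W \<omega> = w)
      \<le> \<P>(\<omega> in measure_pmf Q. U \<omega> = e w \<bar> W \<omega> = w))"
    by metis
  then have "MAP_estimator Q A U W e"
    unfolding MAP_estimator_def by blast
  then show ?thesis by (rule that)
qed

text \<open>Keeps the quotient of success probabilities and its logarithm away from division by zero
  and \<open>ln 0\<close>. On the observation made at any outcome of the support, the estimator does
  at least as well as guessing the value that \<open>U\<close> takes there.\<close>

lemma MAP_estimator_success_pos: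
  assumes "MAP_estimator Q A U W e" "U ` set_pmf Q \<subseteq> A"
  shows "0 < measure_pmf.prob Q {\<omega>. U \<omega> = e (W \<omega>)}"
proof -
  obtain \<omega>\<^sub>0 where \<omega>\<^sub>0: "\<omega>\<^sub>0 \<in> set_pmf Q"
    using set_pmf_not_empty by fast
  have "0 < measure_pmf.prob Q {\<omega>. U \<omega> = U \<omega>\<^sub>0 \<and> W \<omega> = W \<omega>\<^sub>0}"
    using \<omega>\<^sub>0 by (intro measure_pmf_posI) auto
  also have "\<dots> \<le> measure_pmf.prob Q {\<omega>. U \<omega> = e (W \<omega>\<^sub>0) \<and> W \<omega> = W \<omega>\<^sub>0}"
    using assms \<omega>\<^sub>0 by (intro MAP_estimator_optimal[OF assms(1)]) auto
  also have "\<dots> \<le> measure_pmf.prob Q {\<omega>. U \<omega> = e (W \<omega>)}"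
    by (intro measure_pmf.finite_measure_mono) auto
  finally show ?thesis .
qed

text \<open>The point where the upper bound uses the Markov condition: given
  \<open>W = (x, z)\<close> the law of \<open>(U, Y)\<close> is a product whose
  \<open>Y\<close>-factor is at most \<open>m\<close>. Summing over \<open>x\<close> then removes
  \<open>x\<close> from both sides.\<close>

lemma cond_indep_joint_le:
  fixes W :: "'a \<Rightarrow> 'x::finite \<times> 'z"
  assumes "cond_indep Q U Y W"
    and le: "\<And>x. 0 < measure_pmf.prob Q {\<omega>. W \<omega> = (x, z)} \<Longrightarrow>
      \<P>(\<omega> in measure_pmf Q. Y \<omega> = y \<bar> W \<omega> = (x, z)) \<le> m"
  shows "measure_pmf.prob Q {\<omega>. U \<omega> = u \<and> Y \<omega> = y \<and> snd (W \<omega>) = z}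
    \<le> m * measure_pmf.prob Q {\<omega>. U \<omega> = u \<and> snd (W \<omega>) = z}"
proof -
  have "measure_pmf.prob Q {\<omega>. U \<omega> = u \<and> Y \<omega> = y \<and> W \<omega> = (x, z)}
      \<le> m * measure_pmf.prob Q {\<omega>. U \<omega> = u \<and> W \<omega> = (x, z)}" for x
  proof (cases "0 < measure_pmf.prob Q {\<omega>. W \<omega> = (x, z)}")
    case True
    let ?c = "measure_pmf.prob Q {\<omega>. W \<omega> = (x, z)}"
    let ?v = "measure_pmf.prob Q {\<omega>. U \<omega> = u \<and> W \<omega> = (x, z)}"
    have "measure_pmf.prob Q {\<omega>. U \<omega> = u \<and> Y \<omega> = y \<and> W \<omega> = (x, z)} / ?c
        = ?v / ?c * \<P>(\<omega> in measure_pmf Q. Y \<omega> = y \<bar> W \<omega> = (x, z))"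
      using assms(1) True unfolding cond_indep_def
      by (auto simp: cond_prob_def)
    also have "\<dots> \<le> ?v / ?c * m"
      by (intro mult_left_mono le True) auto
    finally show ?thesis
      using True by (simp add: field_simps)
  next
    case False
    then have zero: "measure_pmf.prob Q {\<omega>. W \<omega> = (x, z)} = 0"
      by (simp add: zero_less_measure_iff)
    \<comment> \<open>Conditional independence is silent about null events, but here both sides are
      probabilities of subsets of one.\<close>
    have "measure_pmf.prob Q {\<omega>. R \<omega> \<and> W \<omega> = (x, z)} \<le> measure_pmf.prob Q {\<omega>. W \<omega> = (x, z)}" for R
      by (intro measure_pmf.finite_measure_mono) auto
    from this[of "\<lambda>\<omega>. U \<omega> = u \<and> Y \<omega> = y"] this[of "\<lambda>\<omega>. U \<omega> = u"] zero show ?thesis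
      by (simp add: measure_le_0_iff)
  qed
  then have "(\<Sum>x\<in>UNIV. measure_pmf.prob Q {\<omega>. U \<omega> = u \<and> Y \<omega> = y \<and> W \<omega> = (x, z)})
      \<le> (\<Sum>x\<in>UNIV. m * measure_pmf.prob Q {\<omega>. U \<omega> = u \<and> W \<omega> = (x, z)})"
    by (rule sum_mono)
  then show ?thesis
    by (subst (1 2) prob_eq_sum_fibres[where W = "\<lambda>\<omega>. fst (W \<omega>)"])
       (simp add: sum_distrib_left prod_eq_iff conj_ac)
qed

section \<open>The inner maximum over \<open>x\<close>\<close>

definition max_likelihood :: "('x \<times> 'y \<times> 'z) pmf \<Rightarrow> 'y \<Rightarrow> 'z \<Rightarrow> real" where
  "max_likelihood P y z =
    (MAX x \<in> {x. \<P>((x', y', z') in measure_pmf P. x' = x \<bar> z' = z) > 0}.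
      \<P>((x', y', z') in measure_pmf P. y' = y \<bar> x' = x \<and> z' = z))"

abbreviation prob_xz :: "('x \<times> 'y \<times> 'z) pmf \<Rightarrow> 'x \<Rightarrow> 'z \<Rightarrow> real" where
  "prob_xz P x z \<equiv> measure_pmf.prob P {\<omega>. fst \<omega> = x \<and> snd (snd \<omega>) = z}"

abbreviation prob_z :: "('x \<times> 'y \<times> 'z) pmf \<Rightarrow> 'z \<Rightarrow> real" where
  "prob_z P z \<equiv> measure_pmf.prob P {\<omega>. snd (snd \<omega>) = z}"

lemma prob_xz_le_prob_z: "prob_xz P x z \<le> prob_z P z"
  by (intro measure_pmf.finite_measure_mono) auto

lemma cond_prob_y_given_xz:
  "\<P>((x', y', z') in measure_pmf P. y' = y \<bar> x' = x \<and> z' = z) = pmf P (x, y, z) / prob_xz P x z"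
  unfolding cond_prob_def measure_pmf_single[symmetric]
  by (intro arg_cong2[where f = "(/)"] arg_cong[where f = "measure_pmf.prob P"]) auto

lemma cond_prob_x_given_z_pos_iff:
  "0 < \<P>((x', y', z') in measure_pmf P. x' = x \<bar> z' = z) \<longleftrightarrow> 0 < prob_xz P x z"
proof -
  have "\<P>((x', y', z') in measure_pmf P. x' = x \<bar> z' = z) = prob_xz P x z / prob_z P z"
    unfolding cond_prob_def
    by (intro arg_cong2[where f = "(/)"] arg_cong[where f = "measure_pmf.prob P"]) auto
  then show ?thesis
    using prob_xz_le_prob_z[of P x z] by (auto simp: zero_less_divide_iff zero_less_measure_iff measure_le_0_iff)
qed

lemma max_likelihood_alt:
  "max_likelihood P y z = (MAX x \<in> {x. 0 < prob_xz P x z}. pmf P (x, y, z) / prob_xz P x z)"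
  unfolding max_likelihood_def cond_prob_y_given_xz cond_prob_x_given_z_pos_iff ..

lemma max_likelihood_ge:
  fixes P :: "('x::finite \<times> 'y \<times> 'z) pmf"
  assumes "0 < prob_xz P x z"
  shows "pmf P (x, y, z) / prob_xz P x z \<le> max_likelihood P y z"
  unfolding max_likelihood_alt using assms by (intro Max_ge) auto

lemma prob_z_pos_imp_atom:
  assumes "0 < prob_z P z"
  obtains x y where "0 < pmf P (x, y, z)" "0 < prob_xz P x z"
proof -
  have "set_pmf P \<inter> {\<omega>. snd (snd \<omega>) = z} \<noteq> {}"
    using assms by (metis measure_Int_set_pmf measure_empty less_irrefl inf_commute)
  then obtain x y where "(x, y, z) \<in> set_pmf P" by auto
  then show ?thesis
    by (intro that[of x y] measure_pmf_posI) (auto simp: pmf_positive)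
qed

text \<open>\<open>Max\<close> of the empty set has no specified value; positive mass at
  \<open>z\<close> provides an \<open>x\<close> to maximize over.\<close>

lemma max_likelihood_attained:
  fixes P :: "('x::finite \<times> 'y \<times> 'z) pmf"
  assumes "0 < prob_z P z"
  obtains x where "0 < prob_xz P x z" "max_likelihood P y z = pmf P (x, y, z) / prob_xz P x z"
proof -
  have "{x. 0 < prob_xz P x z} \<noteq> {}"
    using prob_z_pos_imp_atom[OF assms] by blast
  then have "max_likelihood P y z \<in> (\<lambda>x. pmf P (x, y, z) / prob_xz P x z) ` {x. 0 < prob_xz P x z}"
    unfolding max_likelihood_alt by (intro Max_in) auto
  then show ?thesis using that by auto
qed

lemma max_likelihood_nonneg:
  fixes P :: "('x::finite \<times> 'y \<times> 'z) pmf"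
  assumes "0 < prob_z P z"
  shows "0 \<le> max_likelihood P y z"
proof -
  obtain x where "max_likelihood P y z = pmf P (x, y, z) / prob_xz P x z"
    using max_likelihood_attained[OF assms] .
  then show ?thesis by simp
qed

text \<open>The sum is the exponential of the unconditional maximal leakage for the law of
  \<open>(X, Y)\<close> given \<open>Z = z\<close>; its positivity makes \<open>ln\<close> well
  behaved. An atom with \<open>Z = z\<close> contributes a positive term, and no term is
  negative.\<close>

lemma sum_max_likelihood_pos:
  fixes P :: "('x::finite \<times> 'y::finite \<times> 'z) pmf"
  assumes "0 < prob_z P z"
  shows "0 < (\<Sum>y\<in>UNIV. max_likelihood P y z)"
proof -
  obtain x y where xy: "0 < pmf P (x, y, z)" "0 < prob_xz P x z"
    using prob_z_pos_imp_atom[OF assms] .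
  have "0 < pmf P (x, y, z) / prob_xz P x z"
    by (intro divide_pos_pos xy)
  also have "\<dots> \<le> max_likelihood P y z"
    by (rule max_likelihood_ge[OF xy(2)])
  finally have "0 < max_likelihood P y z" .
  moreover have "0 \<le> max_likelihood P y' z" for y'
    by (rule max_likelihood_nonneg[OF assms])
  ultimately show ?thesis
    by (intro sum_pos2[of _ y]) auto
qed

section \<open>Upper bound on the quotient of success probabilities\<close>

lemma success_ratio_le:
  fixes Q :: "('u \<times> 'x::finite \<times> 'y::finite \<times> 'z::finite) pmf"
  assumes supp: "fst ` set_pmf Q \<subseteq> A" and P: "map_pmf snd Q = P"
    and indep: "cond_indep Q (\<lambda>(u, x, y, z). u) (\<lambda>(u, x, y, z). y) (\<lambda>(u, x, y, z). (x, z))"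
    and Uhat: "MAP_estimator Q A (\<lambda>(u, x, y, z). u) (\<lambda>(u, x, y, z). (y, z)) Uhat"
    and Utilde: "MAP_estimator Q A (\<lambda>(u, x, y, z). u) (\<lambda>(u, x, y, z). z) Utilde"
    and S: "\<And>z. 0 < prob_z P z \<Longrightarrow> (\<Sum>y\<in>UNIV. max_likelihood P y z) \<le> S"
  shows "0 < \<P>((u, x, y, z) in measure_pmf Q. u = Uhat (y, z)) /
      \<P>((u, x, y, z) in measure_pmf Q. u = Utilde z)" (is "0 < ?n / ?d")
    and "\<P>((u, x, y, z) in measure_pmf Q. u = Uhat (y, z)) /
      \<P>((u, x, y, z) in measure_pmf Q. u = Utilde z) \<le> S"
proof -
  let ?U = "\<lambda>(u, x, y, z). u" and ?Y = "\<lambda>(u, x, y, z). y" and ?Z = "\<lambda>(u, x, y, z). z"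
    and ?YZ = "\<lambda>(u, x, y, z). (y, z)"
  have supp': "?U ` set_pmf Q \<subseteq> A"
    using supp by auto
  have n: "?n = measure_pmf.prob Q {\<omega>. ?U \<omega> = Uhat (?YZ \<omega>)}"
    and d: "?d = measure_pmf.prob Q {\<omega>. ?U \<omega> = Utilde (?Z \<omega>)}"
    by (rule arg_cong[where f = "measure_pmf.prob Q"]; auto)+
  have n_pos: "0 < ?n" and d_pos: "0 < ?d"
    unfolding n d by (rule MAP_estimator_success_pos[OF Uhat supp'] MAP_estimator_success_pos[OF Utilde supp'])+
  then show "0 < ?n / ?d" by simp
  let ?t = "\<lambda>z. measure_pmf.prob Q {\<omega>. ?U \<omega> = Utilde z \<and> ?Z \<omega> = z}"
  have prob_P: "measure_pmf.prob P B = measure_pmf.prob Q (snd -` B)" for B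
    unfolding P[symmetric] by simp
  have le: "measure_pmf.prob Q {\<omega>. ?U \<omega> = Uhat (y, z) \<and> ?YZ \<omega> = (y, z)} \<le> max_likelihood P y z * ?t z"
    if z: "0 < prob_z P z" for y z
  proof -
    have "measure_pmf.prob Q {\<omega>. ?U \<omega> = Uhat (y, z) \<and> ?YZ \<omega> = (y, z)}
      = measure_pmf.prob Q {\<omega>. ?U \<omega> = Uhat (y, z) \<and> ?Y \<omega> = y \<and> snd ((\<lambda>(u, x, y, z). (x, z)) \<omega>) = z}"
      by (rule arg_cong[where f = "measure_pmf.prob Q"]) auto
    also have "\<dots> \<le> max_likelihood P y z *
        measure_pmf.prob Q {\<omega>. ?U \<omega> = Uhat (y, z) \<and> snd ((\<lambda>(u, x, y, z). (x, z)) \<omega>) = z}"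
    proof (rule cond_indep_joint_le[OF indep])
      fix x
      assume pos: "0 < measure_pmf.prob Q {\<omega>. (\<lambda>(u, x, y, z). (x, z)) \<omega> = (x, z)}"
      have xz: "prob_xz P x z = measure_pmf.prob Q {\<omega>. (\<lambda>(u, x, y, z). (x, z)) \<omega> = (x, z)}"
        unfolding prob_P by (rule arg_cong[where f = "measure_pmf.prob Q"]) auto
      have "pmf P (x, y, z) = measure_pmf.prob Q {\<omega>. ?Y \<omega> = y \<and> (\<lambda>(u, x, y, z). (x, z)) \<omega> = (x, z)}"
        unfolding measure_pmf_single[symmetric] prob_P
        by (rule arg_cong[where f = "measure_pmf.prob Q"]) auto
      then show "\<P>(\<omega> in measure_pmf Q. ?Y \<omega> = y \<bar> (\<lambda>(u, x, y, z). (x, z)) \<omega> = (x, z)) \<le> max_likelihood P y z"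
        using max_likelihood_ge[of P x z y, unfolded xz, OF pos] by (simp add: cond_prob_def)
    qed
    also have "\<dots> \<le> max_likelihood P y z * ?t z"
    proof (rule mult_left_mono)
      show "0 \<le> max_likelihood P y z"
        by (rule max_likelihood_nonneg[OF z])
      \<comment> \<open>Once \<open>y\<close> is fixed, \<open>Uhat (y, z)\<close> is just a letter
        of \<open>A\<close>, hence a rival guess for the estimator that sees \<open>z\<close>
        alone.\<close>
      have "Uhat (y, z) \<in> A" using Uhat by (auto simp: MAP_estimator_def)
      from MAP_estimator_optimal[OF Utilde this, of z]
      show "measure_pmf.prob Q {\<omega>. ?U \<omega> = Uhat (y, z) \<and> snd ((\<lambda>(u, x, y, z). (x, z)) \<omega>) = z} \<le> ?t z"
        by (simp add: case_prod_beta)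
    qed
    finally show ?thesis .
  qed
  have "?n = (\<Sum>(y, z)\<in>UNIV. measure_pmf.prob Q {\<omega>. ?U \<omega> = Uhat (y, z) \<and> ?YZ \<omega> = (y, z)})"
    unfolding n success_prob_eq_sum by (simp add: case_prod_beta)
  also have "\<dots> = (\<Sum>z\<in>UNIV. \<Sum>y\<in>UNIV. measure_pmf.prob Q {\<omega>. ?U \<omega> = Uhat (y, z) \<and> ?YZ \<omega> = (y, z)})"
    by (subst sum.swap) (simp only: sum.cartesian_product UNIV_Times_UNIV)
  also have "\<dots> \<le> (\<Sum>z\<in>UNIV. S * ?t z)"
  proof (rule sum_mono)
    fix z
    show "(\<Sum>y\<in>UNIV. measure_pmf.prob Q {\<omega>. ?U \<omega> = Uhat (y, z) \<and> ?YZ \<omega> = (y, z)}) \<le> S * ?t z"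
    proof (cases "0 < prob_z P z")
      case True
      \<comment> \<open>The factor \<open>?t z\<close> does not depend on \<open>y\<close>, so
        summing over \<open>y\<close> leaves the sum of maxima that \<open>S\<close> bounds.\<close>
      have "(\<Sum>y\<in>UNIV. measure_pmf.prob Q {\<omega>. ?U \<omega> = Uhat (y, z) \<and> ?YZ \<omega> = (y, z)})
          \<le> (\<Sum>y\<in>UNIV. max_likelihood P y z) * ?t z"
        unfolding sum_distrib_right by (intro sum_mono le True)
      also have "\<dots> \<le> S * ?t z"
        by (intro mult_right_mono S True) auto
      finally show ?thesis .
    next
      case False
      \<comment> \<open>Nothing is known about the maxima at such a \<open>z\<close>, but every
        event involved lies in the null event \<open>Z = z\<close>.\<close>
      have "measure_pmf.prob Q {\<omega>. R \<omega> \<and> ?Z \<omega> = z} \<le> prob_z P z" for R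
        unfolding prob_P by (intro measure_pmf.finite_measure_mono) auto
      then have zero: "measure_pmf.prob Q {\<omega>. R \<omega> \<and> ?Z \<omega> = z} = 0" for R
        using False by (meson measure_nonneg order.antisym not_less order_trans)
      have "measure_pmf.prob Q {\<omega>. ?U \<omega> = Uhat (y, z) \<and> ?YZ \<omega> = (y, z)} = 0" for y
      proof -
        have "measure_pmf.prob Q {\<omega>. ?U \<omega> = Uhat (y, z) \<and> ?YZ \<omega> = (y, z)}
            = measure_pmf.prob Q {\<omega>. (?U \<omega> = Uhat (y, z) \<and> ?Y \<omega> = y) \<and> ?Z \<omega> = z}"
          by (rule arg_cong[where f = "measure_pmf.prob Q"]) auto
        also have "\<dots> = 0" by (rule zero)
        finally show ?thesis .
      qed
      then show ?thesis using zero by simp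
    qed
  qed
  also have "\<dots> = S * ?d"
    unfolding d success_prob_eq_sum sum_distrib_left ..
  finally show "?n / ?d \<le> S"
    using d_pos by (simp add: divide_le_eq)
qed

section \<open>Joint laws in which \<open>U\<close> is drawn through a channel from
  \<open>(X, Z)\<close>\<close>

definition channel_joint :: "('x \<times> 'y \<times> 'z) pmf \<Rightarrow> ('x \<Rightarrow> 'z \<Rightarrow> 'u pmf) \<Rightarrow> ('u \<times> 'x \<times> 'y \<times> 'z) pmf" where
  "channel_joint P K = bind_pmf P (\<lambda>(x, y, z). map_pmf (\<lambda>u. (u, x, y, z)) (K x z))"

lemma map_snd_channel_joint: "map_pmf snd (channel_joint P K) = P"
  by (simp add: channel_joint_def map_bind_pmf case_prod_beta pmf.map_comp o_def map_pmf_const bind_return_pmf')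

lemma pmf_channel_joint:
  fixes P :: "('x::finite \<times> 'y::finite \<times> 'z::finite) pmf"
  shows "pmf (channel_joint P K) (u, x, y, z) = pmf P (x, y, z) * pmf (K x z) u"
proof -
  \<comment> \<open>The channel output retains the triple it came from, so only one term of the
    mixture over \<open>P\<close> can produce a given outcome.\<close>
  have *: "pmf (case \<omega> of (x, y, z) \<Rightarrow> map_pmf (\<lambda>u. (u, x, y, z)) (K x z)) (u, x, y, z)
      = (if \<omega> = (x, y, z) then pmf (K x z) u else 0)" for \<omega>
  proof (cases "\<omega> = (x, y, z)")
    case True
    then show ?thesis
      using pmf_map_inj'[of "\<lambda>u. (u, x, y, z)" "K x z" u] by (simp add: inj_def)
  next
    case False
    then show ?thesis
      by (auto simp: pmf_eq_0_set_pmf split: prod.splits)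
  qed
  then show ?thesis
    unfolding channel_joint_def pmf_bind
    by (subst integral_measure_pmf[where A = UNIV]) (simp_all add: * if_distrib sum.delta cong: if_cong)
qed

lemma prob_xz_eq_sum:
  fixes P :: "('x::finite \<times> 'y::finite \<times> 'z::finite) pmf"
  shows "prob_xz P x z = (\<Sum>y\<in>UNIV. pmf P (x, y, z))"
proof -
  have fibre: "{\<omega>. fst \<omega> = x \<and> snd (snd \<omega>) = z} = range (\<lambda>y. (x, y, z))" by force
  show ?thesis
    unfolding fibre by (simp add: measure_measure_pmf_finite sum.reindex inj_on_def)
qed

lemma prob_z_eq_sum:
  fixes P :: "('x::finite \<times> 'y::finite \<times> 'z::finite) pmf"
  shows "prob_z P z = (\<Sum>x\<in>UNIV. prob_xz P x z)"
  using prob_eq_sum_fibres[of P "\<lambda>\<omega>. snd (snd \<omega>) = z" fst] by (simp add: conj_commute)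

lemma sum_prob_z:
  fixes P :: "('x::finite \<times> 'y::finite \<times> 'z::finite) pmf"
  shows "(\<Sum>z\<in>UNIV. prob_z P z) = 1"
  using prob_eq_sum_fibres[of P "\<lambda>_. True" "\<lambda>\<omega>. snd (snd \<omega>)"] by simp

lemma prob_channel_joint_u_xz:
  fixes P :: "('x::finite \<times> 'y::finite \<times> 'z::finite) pmf"
  shows "measure_pmf.prob (channel_joint P K) {\<omega>. fst \<omega> = u \<and> fst (snd \<omega>) = x \<and> snd (snd (snd \<omega>)) = z}
    = prob_xz P x z * pmf (K x z) u"
proof -
  have fibre: "{\<omega>. fst \<omega> = u \<and> fst (snd \<omega>) = x \<and> snd (snd (snd \<omega>)) = z} = range (\<lambda>y. (u, x, y, z))" by force
  show ?thesis
    unfolding fibre by (simp add: measure_measure_pmf_finite pmf_channel_joint sum.reindex inj_on_def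
        prob_xz_eq_sum sum_distrib_right)
qed

lemma prob_channel_joint_u_z:
  fixes P :: "('x::finite \<times> 'y::finite \<times> 'z::finite) pmf"
  shows "measure_pmf.prob (channel_joint P K) {\<omega>. fst \<omega> = u \<and> snd (snd (snd \<omega>)) = z}
    = (\<Sum>x\<in>UNIV. prob_xz P x z * pmf (K x z) u)"
  unfolding prob_channel_joint_u_xz[symmetric]
  using prob_eq_sum_fibres[of "channel_joint P K" "\<lambda>\<omega>. fst \<omega> = u \<and> snd (snd (snd \<omega>)) = z" "\<lambda>\<omega>. fst (snd \<omega>)"]
  by (simp add: conj_ac)

text \<open>The kernel \<open>K\<close> does not see \<open>y\<close>: given \<open>(x, z)\<close>
  of positive mass, \<open>U\<close> has law \<open>K x z\<close> for every value of
  \<open>Y\<close>.\<close>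

lemma cond_indep_channel_joint:
  fixes P :: "('x::finite \<times> 'y::finite \<times> 'z::finite) pmf"
  shows "cond_indep (channel_joint P K) (\<lambda>(u, x, y, z). u) (\<lambda>(u, x, y, z). y) (\<lambda>(u, x, y, z). (x, z))"
  unfolding cond_indep_def
proof (intro allI impI)
  let ?Q = "channel_joint P K"
  fix u y and w :: "'x \<times> 'z"
  obtain x z where w: "w = (x, z)" by (cases w)
  have prob_P: "measure_pmf.prob ?Q (snd -` B) = measure_pmf.prob P B" for B
    by (metis map_snd_channel_joint measure_map_pmf)
  assume "0 < \<P>(\<omega> in measure_pmf ?Q. (case \<omega> of (u, x, y, z) \<Rightarrow> (x, z)) = w)"
  moreover have xz: "\<P>(\<omega> in measure_pmf ?Q. (case \<omega> of (u, x, y, z) \<Rightarrow> (x, z)) = w) = prob_xz P x z"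
    unfolding prob_P[symmetric] w by (rule arg_cong[where f = "measure_pmf.prob ?Q"]) auto
  ultimately have pos: "0 < prob_xz P x z" by simp
  have uy: "\<P>(\<omega> in measure_pmf ?Q. ((case \<omega> of (u, x, y, z) \<Rightarrow> u) = u \<and> (case \<omega> of (u, x, y, z) \<Rightarrow> y) = y)
      \<and> (case \<omega> of (u, x, y, z) \<Rightarrow> (x, z)) = w) = pmf P (x, y, z) * pmf (K x z) u"
    unfolding pmf_channel_joint[symmetric] measure_pmf_single[of "channel_joint P K", symmetric] w
    by (rule arg_cong[where f = "measure_pmf.prob ?Q"]) auto
  have u: "\<P>(\<omega> in measure_pmf ?Q. (case \<omega> of (u, x, y, z) \<Rightarrow> u) = u
      \<and> (case \<omega> of (u, x, y, z) \<Rightarrow> (x, z)) = w) = prob_xz P x z * pmf (K x z) u"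
    unfolding prob_channel_joint_u_xz[symmetric] w
    by (rule arg_cong[where f = "measure_pmf.prob ?Q"]) auto
  have y: "\<P>(\<omega> in measure_pmf ?Q. (case \<omega> of (u, x, y, z) \<Rightarrow> y) = y
      \<and> (case \<omega> of (u, x, y, z) \<Rightarrow> (x, z)) = w) = pmf P (x, y, z)"
    unfolding measure_pmf_single[symmetric] prob_P[symmetric] w
    by (rule arg_cong[where f = "measure_pmf.prob ?Q"]) auto
  show "\<P>(\<omega> in measure_pmf ?Q. (case \<omega> of (u, x, y, z) \<Rightarrow> u) = u \<and> (case \<omega> of (u, x, y, z) \<Rightarrow> y) = y
        \<bar> (case \<omega> of (u, x, y, z) \<Rightarrow> (x, z)) = w)
      = \<P>(\<omega> in measure_pmf ?Q. (case \<omega> of (u, x, y, z) \<Rightarrow> u) = u \<bar> (case \<omega> of (u, x, y, z) \<Rightarrow> (x, z)) = w)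
      * \<P>(\<omega> in measure_pmf ?Q. (case \<omega> of (u, x, y, z) \<Rightarrow> y) = y \<bar> (case \<omega> of (u, x, y, z) \<Rightarrow> (x, z)) = w)"
    unfolding cond_prob_def uy u y xz using pos by simp
qed

section \<open>Lower bound: a \<open>U\<close> that reveals \<open>X\<close> with tuned
  probability\<close>

definition reveal_or_uniform :: "real \<Rightarrow> nat \<Rightarrow> nat \<Rightarrow> nat pmf" where
  "reveal_or_uniform p N a =
    bind_pmf (bernoulli_pmf p) (\<lambda>b. if b then return_pmf a else pmf_of_set {..<N})"

text \<open>The uniform letters may include \<open>a\<close>, so \<open>a\<close> can receive more
  than \<open>p\<close>. Bounding the weight \<open>1 - p\<close> of the uniform part by 1 from
  above and by 0 from below gives one-sided estimates valid in either case.\<close>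

lemma
  assumes "0 \<le> p" "p \<le> 1" "0 < N"
  shows pmf_reveal_or_uniform_le: "pmf (reveal_or_uniform p N a) u \<le> (if u = a then p else 0) + 1 / N"
    and pmf_reveal_or_uniform_ge: "p \<le> pmf (reveal_or_uniform p N a) a"
    and set_pmf_reveal_or_uniform: "set_pmf (reveal_or_uniform p N a) \<subseteq> insert a {..<N}"
proof -
  have ne: "{..<N} \<noteq> {}" using assms by auto
  have *: "pmf (reveal_or_uniform p N a) u
      = p * (if u = a then 1 else 0) + (1 - p) * (indicator {..<N} u / N)" for u
    unfolding reveal_or_uniform_def pmf_bind using assms ne
    by (simp add: pmf_return indicator_def)
  have "(1 - p) * (indicator {..<N} u / N) \<le> 1 * (1 / N)"
    using assms by (intro mult_mono divide_right_mono) (auto simp: indicator_def)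
  then show "pmf (reveal_or_uniform p N a) u \<le> (if u = a then p else 0) + 1 / N"
    unfolding * by auto
  show "p \<le> pmf (reveal_or_uniform p N a) a"
    unfolding * using assms by simp
  show "set_pmf (reveal_or_uniform p N a) \<subseteq> insert a {..<N}"
    unfolding reveal_or_uniform_def by (auto simp: set_pmf_of_set[OF ne] split: if_splits)
qed

text \<open>The construction at a fixed \<open>N\<close>. The quotient reaches the sum of maxima at
  \<open>z\<^sub>0\<close> up to the factor \<open>\<delta> / (\<delta> + 1 / N)\<close>, which
  tends to 1 as \<open>N\<close> grows.\<close>

lemma success_ratio_approx:
  fixes P :: "('x::finite \<times> 'y::finite \<times> 'z::finite) pmf"
  assumes z\<^sub>0: "0 < prob_z P z\<^sub>0" and N: "0 < (N::nat)"
    and \<delta>: "0 < \<delta>" "\<And>x. 0 < prob_xz P x z\<^sub>0 \<Longrightarrow> \<delta> \<le> prob_xz P x z\<^sub>0"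
  obtains A :: "nat set" and Q Uhat Utilde where
    "finite A" "fst ` set_pmf Q \<subseteq> A" "map_pmf snd Q = P"
    "cond_indep Q (\<lambda>(u, x, y, z). u) (\<lambda>(u, x, y, z). y) (\<lambda>(u, x, y, z). (x, z))"
    "MAP_estimator Q A (\<lambda>(u, x, y, z). u) (\<lambda>(u, x, y, z). (y, z)) Uhat"
    "MAP_estimator Q A (\<lambda>(u, x, y, z). u) (\<lambda>(u, x, y, z). z) Utilde"
    "\<delta> * (\<Sum>y\<in>UNIV. max_likelihood P y z\<^sub>0) / (\<delta> + 1 / N)
      \<le> \<P>((u, x, y, z) in measure_pmf Q. u = Uhat (y, z)) /
          \<P>((u, x, y, z) in measure_pmf Q. u = Utilde z)"
proof -
  \<comment> \<open>Alphabets of \<open>U\<close> are sets of naturals, so \<open>f\<close> encodes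
    the elements of \<open>'x\<close> as letters.\<close>
  obtain f :: "'x \<Rightarrow> nat" where f: "inj f"
    using finite_imp_inj_to_nat_seg[of "UNIV :: 'x set"] by auto
  \<comment> \<open>Chosen so that every \<open>x\<close> possible at \<open>z\<^sub>0\<close> is
    revealed there with the same joint mass \<delta>. The default 0 makes \<open>U\<close> purely
    uniform everywhere else.\<close>
  define p where "p x z = (if z = z\<^sub>0 \<and> 0 < prob_xz P x z then \<delta> / prob_xz P x z else 0)" for x z
  define K where "K x z = reveal_or_uniform (p x z) N (f x)" for x z
  define Q where "Q = channel_joint P K"
  define A where "A = range f \<union> {..<N}"
  have p: "0 \<le> p x z" "p x z \<le> 1" for x z
    using \<delta> by (auto simp: p_def)
  have p_mult: "prob_xz P x z * p x z \<le> (if z = z\<^sub>0 then \<delta> else 0)" for x z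
    using \<delta> by (auto simp: p_def)
  have A: "finite A" "A \<noteq> {}"
    by (auto simp: A_def)
  have "u \<in> A" if "u \<in> set_pmf (K x z)" for x z u
    using that set_pmf_reveal_or_uniform[OF p N] by (fastforce simp: K_def A_def)
  then have supp: "fst ` set_pmf Q \<subseteq> A"
    by (auto simp: Q_def channel_joint_def)
  let ?U = "\<lambda>(u, x, y, z). u" and ?Z = "\<lambda>(u, x, y, z). z" and ?YZ = "\<lambda>(u, x, y, z). (y, z)"
  obtain Uhat where Uhat: "MAP_estimator Q A ?U ?YZ Uhat"
    using MAP_estimator_exists[OF A] .
  obtain Utilde where Utilde: "MAP_estimator Q A ?U ?Z Utilde"
    using MAP_estimator_exists[OF A] .
  let ?n = "\<P>((u, x, y, z) in measure_pmf Q. u = Uhat (y, z))"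
  let ?d = "\<P>((u, x, y, z) in measure_pmf Q. u = Utilde z)"
  have n: "?n = measure_pmf.prob Q {\<omega>. ?U \<omega> = Uhat (?YZ \<omega>)}"
    and d: "?d = measure_pmf.prob Q {\<omega>. ?U \<omega> = Utilde (?Z \<omega>)}"
    by (rule arg_cong[where f = "measure_pmf.prob Q"]; auto)+
  have d_pos: "0 < ?d"
    unfolding d using supp by (intro MAP_estimator_success_pos[OF Utilde]) auto
  have "measure_pmf.prob Q {\<omega>. ?U \<omega> = u \<and> ?Z \<omega> = z} \<le> (if z = z\<^sub>0 then \<delta> else 0) + prob_z P z / N" for u z
  proof -
    have "measure_pmf.prob Q {\<omega>. ?U \<omega> = u \<and> ?Z \<omega> = z} = (\<Sum>x\<in>UNIV. prob_xz P x z * pmf (K x z) u)"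
      unfolding prob_channel_joint_u_z[symmetric] Q_def
      by (rule arg_cong[where f = "measure_pmf.prob (channel_joint P K)"]) auto
    also have "\<dots> \<le> (\<Sum>x\<in>UNIV. prob_xz P x z * ((if u = f x then p x z else 0) + 1 / N))"
      unfolding K_def by (intro sum_mono mult_left_mono pmf_reveal_or_uniform_le p N) auto
    also have "\<dots> = (\<Sum>x\<in>UNIV. if u = f x then prob_xz P x z * p x z else 0) + prob_z P z / N"
      unfolding prob_z_eq_sum sum_divide_distrib sum.distrib[symmetric]
      by (intro sum.cong) (auto simp: distrib_left)
    \<comment> \<open>By injectivity of \<open>f\<close> at most one \<open>x\<close> has the letter
      \<open>u\<close>, so revealing contributes \<delta> once, not once for each
      \<open>x\<close>.\<close>
    also have "(\<Sum>x\<in>UNIV. if u = f x then prob_xz P x z * p x z else 0) \<le> (if z = z\<^sub>0 then \<delta> else 0)"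
    proof (cases "u \<in> range f")
      case True
      then obtain x\<^sub>0 where "u = f x\<^sub>0" by auto
      then have "(\<Sum>x\<in>UNIV. if u = f x then prob_xz P x z * p x z else 0) = prob_xz P x\<^sub>0 z * p x\<^sub>0 z"
        using f by (simp add: inj_eq)
      then show ?thesis using p_mult by simp
    next
      case False
      then have "(\<Sum>x\<in>UNIV. if u = f x then prob_xz P x z * p x z else 0) = 0"
        by (intro sum.neutral) auto
      then show ?thesis using \<delta>(1) by simp
    qed
    finally show ?thesis by simp
  qed
  then have "?d \<le> (\<Sum>z\<in>UNIV. (if z = z\<^sub>0 then \<delta> else 0) + prob_z P z / N)"
    unfolding d success_prob_eq_sum by (rule sum_mono)
  \<comment> \<open>The term \<delta> occurs only at \<open>z\<^sub>0\<close>, and the masses of the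
    values of \<open>Z\<close> add up to 1.\<close>
  also have "\<dots> = \<delta> + 1 / N"
    by (simp add: sum.distrib sum_divide_distrib[symmetric] sum_prob_z)
  finally have d_le: "?d \<le> \<delta> + 1 / N" .
  have "\<delta> * max_likelihood P y z\<^sub>0 \<le> measure_pmf.prob Q {\<omega>. ?U \<omega> = Uhat (y, z\<^sub>0) \<and> ?YZ \<omega> = (y, z\<^sub>0)}" for y
  proof -
    obtain x where x: "0 < prob_xz P x z\<^sub>0" "max_likelihood P y z\<^sub>0 = pmf P (x, y, z\<^sub>0) / prob_xz P x z\<^sub>0"
      using max_likelihood_attained[OF z\<^sub>0] .
    \<comment> \<open>The weight \<open>p x z\<^sub>0\<close> turns the joint mass into \<delta>
      times the likelihood. The MAP guess is then compared with the letter \<open>f x\<close> of a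
      maximizing \<open>x\<close>.\<close>
    have "\<delta> * max_likelihood P y z\<^sub>0 = pmf P (x, y, z\<^sub>0) * p x z\<^sub>0"
      using x by (simp add: p_def)
    also have "\<dots> \<le> pmf Q (f x, x, y, z\<^sub>0)"
      unfolding Q_def pmf_channel_joint K_def
      by (intro mult_left_mono pmf_reveal_or_uniform_ge p N) auto
    also have "\<dots> \<le> measure_pmf.prob Q {\<omega>. ?U \<omega> = f x \<and> ?YZ \<omega> = (y, z\<^sub>0)}"
      unfolding measure_pmf_single[symmetric] by (intro measure_pmf.finite_measure_mono) auto
    also have "\<dots> \<le> measure_pmf.prob Q {\<omega>. ?U \<omega> = Uhat (y, z\<^sub>0) \<and> ?YZ \<omega> = (y, z\<^sub>0)}"
      by (rule MAP_estimator_optimal[OF Uhat]) (simp add: A_def)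
    finally show ?thesis .
  qed
  then have "\<delta> * (\<Sum>y\<in>UNIV. max_likelihood P y z\<^sub>0)
      \<le> (\<Sum>y\<in>UNIV. measure_pmf.prob Q {\<omega>. ?U \<omega> = Uhat (y, z\<^sub>0) \<and> ?YZ \<omega> = (y, z\<^sub>0)})"
    unfolding sum_distrib_left by (rule sum_mono)
  also have "\<dots> = (\<Sum>w\<in>range (\<lambda>y. (y, z\<^sub>0)). measure_pmf.prob Q {\<omega>. ?U \<omega> = Uhat w \<and> ?YZ \<omega> = w})"
    by (subst sum.reindex) (auto simp: inj_on_def)
  \<comment> \<open>Successes at other values of \<open>Z\<close> are discarded.\<close>
  also have "\<dots> \<le> ?n"
    unfolding n success_prob_eq_sum by (rule sum_mono2) auto
  finally have n_ge: "\<delta> * (\<Sum>y\<in>UNIV. max_likelihood P y z\<^sub>0) \<le> ?n" .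
  have "\<delta> * (\<Sum>y\<in>UNIV. max_likelihood P y z\<^sub>0) / (\<delta> + 1 / N) \<le> ?n / ?d"
    by (intro frac_le n_ge d_le d_pos) auto
  then show ?thesis
    using cond_indep_channel_joint[of P K] map_snd_channel_joint[of P K]
    by (intro that[OF A(1) supp _ _ Uhat Utilde]) (simp_all add: Q_def)
qed

section \<open>The two bounds combined\<close>

theorem theorem6:
  fixes P :: "('x::finite \<times> 'y::finite \<times> 'z::finite) pmf"
  shows "cond_maximal_leakage P =
    ereal (ln (MAX z \<in> {z. \<P>((x', y', z') in measure_pmf P. z' = z) > 0}.
                 \<Sum>y\<in>UNIV.
                   MAX x \<in> {x. \<P>((x', y', z') in measure_pmf P. x' = x \<bar> z' = z) > 0}.
                     \<P>((x', y', z') in measure_pmf P. y' = y \<bar> x' = x \<and> z' = z)))"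
proof -
  define S where "S = (MAX z \<in> {z. 0 < prob_z P z}. \<Sum>y\<in>UNIV. max_likelihood P y z)"
  have S_ge: "(\<Sum>y\<in>UNIV. max_likelihood P y z) \<le> S" if "0 < prob_z P z" for z
    unfolding S_def using that by (intro Max_ge) auto
  have "{z. 0 < prob_z P z} \<noteq> {}"
  proof
    assume "{z. 0 < prob_z P z} = {}"
    then have "prob_z P z \<le> 0" for z by (simp add: not_less)
    then have "(\<Sum>z\<in>UNIV. prob_z P z) \<le> 0" by (intro sum_nonpos)
    then show False by (simp add: sum_prob_z)
  qed
  then have "S \<in> (\<lambda>z. \<Sum>y\<in>UNIV. max_likelihood P y z) ` {z. 0 < prob_z P z}"
    unfolding S_def by (intro Max_in) auto
  then obtain z\<^sub>0 where z\<^sub>0: "0 < prob_z P z\<^sub>0" "S = (\<Sum>y\<in>UNIV. max_likelihood P y z\<^sub>0)"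
    by auto
  have S_pos: "0 < S"
    using sum_max_likelihood_pos z\<^sub>0 by metis
  \<comment> \<open>Positive because it is a minimum of finitely many positive masses.\<close>
  define \<delta> where "\<delta> = Min ((\<lambda>x. prob_xz P x z\<^sub>0) ` {x. 0 < prob_xz P x z\<^sub>0})"
  have "{x. 0 < prob_xz P x z\<^sub>0} \<noteq> {}"
    using prob_z_pos_imp_atom[OF z\<^sub>0(1)] by blast
  then have \<delta>_pos: "0 < \<delta>"
    unfolding \<delta>_def by (subst Min_gr_iff) auto
  have \<delta>_le: "\<delta> \<le> prob_xz P x z\<^sub>0" if "0 < prob_xz P x z\<^sub>0" for x
    unfolding \<delta>_def using that by (intro Min_le) auto
  have "cond_maximal_leakage P = ereal (ln S)"
  proof (rule antisym)
    show "cond_maximal_leakage P \<le> ereal (ln S)"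
      unfolding cond_maximal_leakage_def
    proof (rule Sup_least, clarify)
      fix A :: "nat set" and Q Uhat Utilde
      assume Q: "fst ` set_pmf Q \<subseteq> A" "P = map_pmf snd Q"
        "cond_indep Q (\<lambda>(u, x, y, z). u) (\<lambda>(u, x, y, z). y) (\<lambda>(u, x, y, z). (x, z))"
        "MAP_estimator Q A (\<lambda>(u, x, y, z). u) (\<lambda>(u, x, y, z). (y, z)) Uhat"
        "MAP_estimator Q A (\<lambda>(u, x, y, z). u) (\<lambda>(u, x, y, z). z) Utilde"
      note bounds = success_ratio_le[OF Q(1) Q(2)[symmetric] Q(3-5) S_ge]
      show "ereal (ln (\<P>((u, x, y, z) in measure_pmf Q. u = Uhat (y, z)) /
                     \<P>((u, x, y, z) in measure_pmf Q. u = Utilde z))) \<le> ereal (ln S)"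
        using bounds S_pos by (simp only: ereal_less_eq ln_le_cancel_iff)
    qed
  next
    \<comment> \<open>The guarantee of \<open>success_ratio_approx\<close> for
      \<open>N = Suc k\<close>, shifted so that \<open>N\<close> is never 0. In the limit \<delta>
      cancels and \<open>S\<close> remains.\<close>
    let ?r = "\<lambda>k. \<delta> * S / (\<delta> + 1 / real (Suc k))"
    have "(\<lambda>k. 1 / real (Suc k)) \<longlonglongrightarrow> 0"
      using LIMSEQ_inverse_real_of_nat by (simp add: inverse_eq_divide)
    then have "?r \<longlonglongrightarrow> \<delta> * S / (\<delta> + 0)"
      using \<delta>_pos by (intro tendsto_intros) auto
    then have lim: "(\<lambda>k. ereal (ln (?r k))) \<longlonglongrightarrow> ereal (ln S)"
      using \<delta>_pos S_pos by (intro tendsto_intros tendsto_ln) auto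
    have "ereal (ln (?r k)) \<le> cond_maximal_leakage P" for k
    proof -
      obtain A :: "nat set" and Q Uhat Utilde where Q:
        "finite A" "fst ` set_pmf Q \<subseteq> A" "map_pmf snd Q = P"
        "cond_indep Q (\<lambda>(u, x, y, z). u) (\<lambda>(u, x, y, z). y) (\<lambda>(u, x, y, z). (x, z))"
        "MAP_estimator Q A (\<lambda>(u, x, y, z). u) (\<lambda>(u, x, y, z). (y, z)) Uhat"
        "MAP_estimator Q A (\<lambda>(u, x, y, z). u) (\<lambda>(u, x, y, z). z) Utilde"
        and r: "?r k \<le> \<P>((u, x, y, z) in measure_pmf Q. u = Uhat (y, z)) /
          \<P>((u, x, y, z) in measure_pmf Q. u = Utilde z)"
        using success_ratio_approx[OF z\<^sub>0(1) zero_less_Suc \<delta>_pos \<delta>_le, folded z\<^sub>0(2)] .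
      have "0 < ?r k"
        using \<delta>_pos S_pos by (simp add: add_pos_pos)
      with r have "ereal (ln (?r k)) \<le> ereal (ln (\<P>((u, x, y, z) in measure_pmf Q. u = Uhat (y, z)) /
          \<P>((u, x, y, z) in measure_pmf Q. u = Utilde z)))"
        by (simp only: ereal_less_eq ln_mono)
      also have "\<dots> \<le> cond_maximal_leakage P"
        unfolding cond_maximal_leakage_def using Q by (intro Sup_upper) blast
      finally show ?thesis .
    qed
    \<comment> \<open>No single \<open>U\<close> has been shown to attain \<open>ln S\<close>; the
      supremum dominates each \<open>ln (?r k)\<close> and therefore their limit.\<close>
    then show "ereal (ln S) \<le> cond_maximal_leakage P"
      by (intro LIMSEQ_le_const2[OF lim]) blast
  qed
  moreover have "\<P>((x', y', z') in measure_pmf P. z' = z) = prob_z P z" for z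
    by (rule arg_cong[where f = "measure_pmf.prob P"]) auto
  ultimately show ?thesis
    unfolding S_def max_likelihood_def by (simp only:)
qed

end
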